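(* For every orthomodular space $\mathcal{X}=\langle X;\preceq,\perp,\Omega,\mathcal{T}_X\rangle$ there exists a relational homeomorphism $\mathcal{X}\to\mathscr{S}_0(\mathscr{A}_0(\mathcal{X}))$, i.e. a homeomorphism $f$ from $X$ onto the filter space of $\mathscr{A}_0(\mathcal{X})$ such that for all $x,y\in X$: $x\preceq y\iff f(x)\subseteq f(y)$, and $x\perp y\iff f(x)\perp_{A} f(y)$, where $\perp_A$ is the orthogonality relation of $\mathscr{S}_0(\mathscr{A}_0(\mathcal{X}))$.
   Context: An ortholattice is an algebra $\langle A;\cdot,-,0\rangle$ such that $\langle A;\cdot,0\rangle$ is a meet-semilattice with least element $0$ and $-$ satisfies $a\cdot -a=0$, $a\le b\Rightarrow -b\le -a$, $a=--a$; joins are $a+b:=-(-a\cdot -b)$. An orthomodular lattice is an ortholattice satisfying $a\le b\Rightarrow b=a+(-a\cdot b)$. An orthomodular frame is a structure $\langle X;\preceq,\perp,\Omega\rangle$ with $\preceq,\perp\subseteq X\times X$ and $\Omega\subseteq X$ such that: (1) $\langle X;\preceq\rangle$ is a partially ordered meet-semilattice (write $x\cap y:=\inf\{x,y\}$ and ${\uparrow}x=\{y:x\preceq y\}$); (2) $\langle X;\preceq\rangle$ has an upper bound (top element) $\omega$ with $\omega\in\Omega$; (3) for every $x\in\Omega$ there is $z\in\Omega$ such that for all $y$, $x\perp y\Leftrightarrow z\preceq y$, and for all $u$, $z\perp u\Rightarrow x\preceq u$; (4) for all $x,y\in\Omega$: if $y\preceq x$ and for all $z$ ($y\preceq z$ and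 $z\perp x$ imply $z=\omega$), then $x=y$; (5) $x\perp x\Rightarrow x=\omega$; (6) $x,y\in\Omega\Rightarrow x\cap y\in\Omega$; (7) $x\perp\omega$ for all $x$; (8) $x\perp y\Rightarrow y\perp x$; (9) if $x\perp y$ and $x\preceq z$ then $z\perp y$. For $U\subseteq X$, $U^{\perp}:=\{x\in X: x\perp y\text{ for all }y\in U\}$; $U$ is $\perp$-stable if $U=U^{\perp\perp}$. $\mathcal{CO}(\mathcal{X})^{\dagger}$ is the set of clopen $\perp$-stable subsets of $X$. An orthomodular space is $\mathcal{X}=\langle X;\preceq,\perp,\Omega,\mathcal{T}_X\rangle$ such that: (1) $\langle X;\preceq,\perp,\Omega\rangle$ is an orthomodular frame; (2) $\langle X;\mathcal{T}_X\rangle$ is compact; (3) $\mathcal{CO}(\mathcal{X})^{\dagger}$ is closed under $\cap$ and ${}^{\perp}$; (4) each $U\in\mathcal{CO}(\mathcal{X})^{\dagger}$ equals ${\uparrow}z$ for some $z\in\Omega$; (5) if $x\not\preceq y$ there is $U\in\mathcal{CO}(\mathcal{X})^{\dagger}$ with $x\in U$, $y\notin U$; (6) if $x\perp y$ there is $U\in\mathcal{CO}(\mathcal{X})^{\dagger}$ with $x\in U$ and $y\in U^{\perp}$. $\mathscr{A}_0(\mathcal{X})=\langle\mathcal{CO}(\mathcal{X})^{\dagger};\cap,{}^{\perp},\{\omega\}\rangle$. For an orthomodular lattice $\mathfrak{A}$: a filter is a nonempty upward-closed subset closed under binary meets (the improper filter $A$ allowed); $\mathfrak{F}(\mathfrak{A})$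 is the set of filters, $\mathfrak{P}(\mathfrak{A})$ the principal filters; $x\perp_A y$ iff some $a\in x$ has $-a\in y$; with $h(a)=\{x\in\mathfrak{F}(\mathfrak{A}):a\in x\}$, $\mathscr{S}_0(\mathfrak{A})=\langle\mathfrak{F}(\mathfrak{A});\subseteq,\perp_A,\mathfrak{P}(\mathfrak{A}),\mathcal{T}\rangle$ with $\mathcal{T}$ generated by the subbasis $\{h(a)\}_{a\in A}\cup\{\mathfrak{F}(\mathfrak{A})\setminus h(a)\}_{a\in A}$. *)

theory Defs
  imports "HOL-Analysis.Analysis"
begin

record 'a ol_sig =
  elems :: "'a set"
  meet :: "'a \<Rightarrow> 'a \<Rightarrow> 'a"
  compl :: "'a \<Rightarrow> 'a"
  zero :: 'a

definition ol_le :: "('a, 'm) ol_sig_scheme \<Rightarrow> 'a \<Rightarrow> 'a \<Rightarrow> bool"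
  where "ol_le A a b \<longleftrightarrow> meet A a b = a"

definition ol_join :: "('a, 'm) ol_sig_scheme \<Rightarrow> 'a \<Rightarrow> 'a \<Rightarrow> 'a"
  where "ol_join A a b = compl A (meet A (compl A a) (compl A b))"

locale ortholattice =
  fixes A :: "('a, 'm) ol_sig_scheme"
  assumes meet_closed: "\<lbrakk>a \<in> elems A; b \<in> elems A\<rbrakk> \<Longrightarrow> meet A a b \<in> elems A"
    and compl_closed: "a \<in> elems A \<Longrightarrow> compl A a \<in> elems A"
    and zero_closed: "zero A \<in> elems A"
    and meet_assoc: "\<lbrakk>a \<in> elems A; b \<in> elems A; c \<in> elems A\<rbrakk>
      \<Longrightarrow> meet A (meet A a b) c = meet A a (meet A b c)"
    and meet_comm: "\<lbrakk>a \<in> elems A; b \<in> elems A\<rbrakk> \<Longrightarrow> meet A a b = meet A b a"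
    and meet_idem: "a \<in> elems A \<Longrightarrow> meet A a a = a"
    and zero_least: "a \<in> elems A \<Longrightarrow> ol_le A (zero A) a"
    and meet_compl: "a \<in> elems A \<Longrightarrow> meet A a (compl A a) = zero A"
    and compl_antitone: "\<lbrakk>a \<in> elems A; b \<in> elems A; ol_le A a b\<rbrakk>
      \<Longrightarrow> ol_le A (compl A b) (compl A a)"
    and compl_compl: "a \<in> elems A \<Longrightarrow> compl A (compl A a) = a"

locale orthomodular_lattice = ortholattice A for A :: "('a, 'm) ol_sig_scheme" +
  assumes orthomodular: "\<lbrakk>a \<in> elems A; b \<in> elems A; ol_le A a b\<rbrakk>
    \<Longrightarrow> b = ol_join A a (meet A (compl A a) b)"

record 'a om_frame_sig =
  points :: "'a set"
  le :: "'a rel"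
  perp :: "'a rel"
  Omega :: "'a set"

definition is_inf :: "('a, 'm) om_frame_sig_scheme \<Rightarrow> 'a \<Rightarrow> 'a \<Rightarrow> 'a \<Rightarrow> bool"
  where "is_inf F x y w \<longleftrightarrow> w \<in> points F \<and> (w, x) \<in> le F \<and> (w, y) \<in> le F \<and>
    (\<forall>v\<in>points F. (v, x) \<in> le F \<and> (v, y) \<in> le F \<longrightarrow> (v, w) \<in> le F)"

text \<open>Infima and the top element are not part of the signature; the descriptions below denote
  them because their existence is an axiom of orthomodular frames.\<close>

definition frame_inf :: "('a, 'm) om_frame_sig_scheme \<Rightarrow> 'a \<Rightarrow> 'a \<Rightarrow> 'a"
  where "frame_inf F x y = (THE w. is_inf F x y w)"

definition is_top :: "('a, 'm) om_frame_sig_scheme \<Rightarrow> 'a \<Rightarrow> bool"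
  where "is_top F w \<longleftrightarrow> w \<in> points F \<and> (\<forall>x\<in>points F. (x, w) \<in> le F)"

definition omega :: "('a, 'm) om_frame_sig_scheme \<Rightarrow> 'a"
  where "omega F = (THE w. is_top F w)"

definition upset :: "('a, 'm) om_frame_sig_scheme \<Rightarrow> 'a \<Rightarrow> 'a set"
  where "upset F x = {y \<in> points F. (x, y) \<in> le F}"

text \<open>\<^const>\<open>partial_order_on\<close> includes that the relation is contained in the square of its carrier.\<close>

locale orthomodular_frame =
  fixes F :: "('a, 'm) om_frame_sig_scheme"
  assumes perp_subset: "perp F \<subseteq> points F \<times> points F"
    and Omega_subset: "Omega F \<subseteq> points F"
    and partial_order: "partial_order_on (points F) (le F)"
    and inf_exists: "\<lbrakk>x \<in> points F; y \<in> points F\<rbrakk> \<Longrightarrow> \<exists>w. is_inf F x y w"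
    and top_exists: "\<exists>w\<in>Omega F. is_top F w"
    and Omega_compl: "x \<in> Omega F \<Longrightarrow>
      \<exists>z\<in>Omega F. (\<forall>y\<in>points F. (x, y) \<in> perp F \<longleftrightarrow> (z, y) \<in> le F) \<and>
        (\<forall>u\<in>points F. (z, u) \<in> perp F \<longrightarrow> (x, u) \<in> le F)"
    and Omega_orthomodular: "\<lbrakk>x \<in> Omega F; y \<in> Omega F; (y, x) \<in> le F;
      \<forall>z\<in>points F. (y, z) \<in> le F \<and> (z, x) \<in> perp F \<longrightarrow> z = omega F\<rbrakk> \<Longrightarrow> x = y"
    and perp_refl: "\<lbrakk>x \<in> points F; (x, x) \<in> perp F\<rbrakk> \<Longrightarrow> x = omega F"
    and Omega_inf: "\<lbrakk>x \<in> Omega F; y \<in> Omega F\<rbrakk> \<Longrightarrow> frame_inf F x y \<in> Omega F"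
    and perp_omega: "x \<in> points F \<Longrightarrow> (x, omega F) \<in> perp F"
    and perp_sym: "\<lbrakk>x \<in> points F; y \<in> points F; (x, y) \<in> perp F\<rbrakk> \<Longrightarrow> (y, x) \<in> perp F"
    and perp_up: "\<lbrakk>x \<in> points F; y \<in> points F; z \<in> points F; (x, y) \<in> perp F; (x, z) \<in> le F\<rbrakk>
      \<Longrightarrow> (z, y) \<in> perp F"

definition perp_set :: "('a, 'm) om_frame_sig_scheme \<Rightarrow> 'a set \<Rightarrow> 'a set"
  where "perp_set F U = {x \<in> points F. \<forall>y\<in>U. (x, y) \<in> perp F}"

definition perp_stable :: "('a, 'm) om_frame_sig_scheme \<Rightarrow> 'a set \<Rightarrow> bool"
  where "perp_stable F U \<longleftrightarrow> U \<subseteq> points F \<and> U = perp_set F (perp_set F U)"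

record 'a om_space_sig = "'a om_frame_sig" +
  topo :: "'a topology"

definition CO_stable :: "('a, 'm) om_space_sig_scheme \<Rightarrow> 'a set set"
  where "CO_stable X = {U. openin (topo X) U \<and> closedin (topo X) U \<and> perp_stable X U}"

locale orthomodular_space = orthomodular_frame X for X :: "('a, 'm) om_space_sig_scheme" +
  assumes topspace_topo: "topspace (topo X) = points X"
    and compact: "compact_space (topo X)"
    and CO_inter: "\<lbrakk>U \<in> CO_stable X; V \<in> CO_stable X\<rbrakk> \<Longrightarrow> U \<inter> V \<in> CO_stable X"
    and CO_perp: "U \<in> CO_stable X \<Longrightarrow> perp_set X U \<in> CO_stable X"
    and CO_upset: "U \<in> CO_stable X \<Longrightarrow> \<exists>z\<in>Omega X. U = upset X z"
    and CO_separates: "\<lbrakk>x \<in> points X; y \<in> points X; (x, y) \<notin> le X\<rbrakk>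
      \<Longrightarrow> \<exists>U\<in>CO_stable X. x \<in> U \<and> y \<notin> U"
    and CO_perp_separates: "\<lbrakk>x \<in> points X; y \<in> points X; (x, y) \<in> perp X\<rbrakk>
      \<Longrightarrow> \<exists>U\<in>CO_stable X. x \<in> U \<and> y \<in> perp_set X U"

definition relational_homeomorphism ::
    "('a, 'm) om_space_sig_scheme \<Rightarrow> ('b, 'n) om_space_sig_scheme \<Rightarrow> ('a \<Rightarrow> 'b) \<Rightarrow> bool"
  where "relational_homeomorphism X Y f \<longleftrightarrow>
    homeomorphic_map (topo X) (topo Y) f \<and>
    (\<forall>x\<in>points X. \<forall>y\<in>points X.
      ((x, y) \<in> le X \<longleftrightarrow> (f x, f y) \<in> le Y) \<and>
      ((x, y) \<in> perp X \<longleftrightarrow> (f x, f y) \<in> perp Y))"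

definition A0 :: "('a, 'm) om_space_sig_scheme \<Rightarrow> 'a set ol_sig"
  where "A0 X = \<lparr>elems = CO_stable X, meet = (\<inter>), compl = perp_set X, zero = {omega X}\<rparr>"

definition filters :: "('a, 'm) ol_sig_scheme \<Rightarrow> 'a set set"
  where "filters A = {F. F \<subseteq> elems A \<and> F \<noteq> {} \<and>
    (\<forall>a\<in>F. \<forall>b\<in>elems A. ol_le A a b \<longrightarrow> b \<in> F) \<and>
    (\<forall>a\<in>F. \<forall>b\<in>F. meet A a b \<in> F)}"

definition principal_filters :: "('a, 'm) ol_sig_scheme \<Rightarrow> 'a set set"
  where "principal_filters A = {{b \<in> elems A. ol_le A a b} | a. a \<in> elems A}"

definition filters_with :: "('a, 'm) ol_sig_scheme \<Rightarrow> 'a \<Rightarrow> 'a set set"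
  where "filters_with A a = {F \<in> filters A. a \<in> F}"

definition S0 :: "('a, 'm) ol_sig_scheme \<Rightarrow> 'a set om_space_sig"
  where "S0 A =
    \<lparr>points = filters A,
     le = {(F, G). F \<in> filters A \<and> G \<in> filters A \<and> F \<subseteq> G},
     perp = {(F, G). F \<in> filters A \<and> G \<in> filters A \<and> (\<exists>a\<in>F. compl A a \<in> G)},
     Omega = principal_filters A,
     topo = topology_generated_by
       (filters_with A ` elems A \<union> (\<lambda>a. filters A - filters_with A a) ` elems A)\<rparr>"

text \<open>\<^const>\<open>S0\<close> is meant for orthomodular lattices. \<open>orthomodular_lattice_A0\<close> below shows
  that \<^const>\<open>A0\<close> of an orthomodular space is one, and \<open>topspace_S0\<close> that the generated
  topology lives on the set of all filters.\<close>

lemma (in orthomodular_lattice) topspace_S0: "topspace (topo (S0 A)) = points (S0 A)"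
proof -
  have "filters A \<subseteq> filters_with A (zero A) \<union> (filters A - filters_with A (zero A))"
    by blast
  then show ?thesis
    using zero_closed by (auto simp: S0_def filters_with_def)
qed

context orthomodular_frame
begin

lemma is_top_omega: "is_top F (omega F)"
proof -
  obtain w where w: "is_top F w" using top_exists by blast
  have "v = w" if "is_top F v" for v
    using that w partial_order
    unfolding is_top_def partial_order_on_def antisym_def by blast
  then show ?thesis unfolding omega_def using w by (metis theI)
qed

lemma perp_set_antitone: "U \<subseteq> V \<Longrightarrow> perp_set F V \<subseteq> perp_set F U"
  by (auto simp: perp_set_def)

lemma perp_set_points: "perp_set F (points F) = {omega F}"
  using perp_refl perp_omega perp_sym is_top_omega
  unfolding perp_set_def is_top_def by blast

lemma perp_set_omega: "perp_set F {omega F} = points F"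
  using perp_omega by (auto simp: perp_set_def)

end

lemma (in orthomodular_space) orthomodular_lattice_A0: "orthomodular_lattice (A0 X)"
proof -
  have top: "points X \<in> CO_stable X"
    using openin_topspace[of "topo X"] closedin_topspace[of "topo X"]
    by (simp add: CO_stable_def perp_stable_def perp_set_points perp_set_omega topspace_topo)
  have zero: "{omega X} \<in> CO_stable X"
    using CO_perp[OF top] by (simp add: perp_set_points)
  have sub: "U \<subseteq> points X" and stable: "perp_set X (perp_set X U) = U"
    if "U \<in> CO_stable X" for U
    using that by (auto simp: CO_stable_def perp_stable_def)
  have omega_in: "omega X \<in> U" if "U \<in> CO_stable X" for U
  proof -
    have "omega X \<in> perp_set X (perp_set X U)"
      using perp_omega perp_sym is_top_omega unfolding perp_set_def is_top_def by blast
    then show ?thesis using stable[OF that] by simp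
  qed
  have disj: "U \<inter> perp_set X U = {omega X}" if U: "U \<in> CO_stable X" for U
    using perp_refl sub[OF U] omega_in[OF U] omega_in[OF CO_perp[OF U]]
    unfolding perp_set_def by blast
  have eq: "U = V"
    if U: "U \<in> CO_stable X" and V: "V \<in> CO_stable X" and "U \<subseteq> V"
      and triv: "V \<inter> perp_set X U = {omega X}" for U V
  proof -
    obtain x where x: "x \<in> Omega X" "U = upset X x" using CO_upset[OF U] by blast
    obtain y where y: "y \<in> Omega X" "V = upset X y" using CO_upset[OF V] by blast
    have "(x, x) \<in> le X"
      using x(1) Omega_subset partial_order_onD(1)[OF partial_order]
      by (auto simp: refl_on_def)
    then have xU: "x \<in> U" using x Omega_subset by (auto simp: upset_def)
    then have yx: "(y, x) \<in> le X" using \<open>U \<subseteq> V\<close> y by (auto simp: upset_def)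
    have "z = omega X" if "z \<in> points X" "(y, z) \<in> le X" "(z, x) \<in> perp X" for z
    proof -
      have "z \<in> V" using that y by (simp add: upset_def)
      moreover have "(z, u) \<in> perp X" if "u \<in> U" for u
      proof -
        have "u \<in> points X" "(x, u) \<in> le X" using that x(2) by (auto simp: upset_def)
        moreover have "x \<in> points X" using x(1) Omega_subset by blast
        ultimately show ?thesis
          using \<open>z \<in> points X\<close> \<open>(z, x) \<in> perp X\<close> perp_sym perp_up by metis
      qed
      ultimately have "z \<in> V \<inter> perp_set X U"
        using \<open>z \<in> points X\<close> by (simp add: perp_set_def)
      then show ?thesis using triv by blast
    qed
    then have "x = y" using Omega_orthomodular x y yx by blast
    then show ?thesis using x y by simp
  qed
  have om: "V = perp_set X (perp_set X U \<inter> perp_set X (perp_set X U \<inter> V))"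
    if U: "U \<in> CO_stable X" and V: "V \<in> CO_stable X" and UV: "U \<subseteq> V" for U V
  proof -
    let ?W = "perp_set X U \<inter> V"
    let ?J = "perp_set X (perp_set X U \<inter> perp_set X ?W)"
    have W: "?W \<in> CO_stable X" using U V CO_inter CO_perp by blast
    have M: "perp_set X U \<inter> perp_set X ?W \<in> CO_stable X" using U W CO_inter CO_perp by blast
    have J: "?J \<in> CO_stable X" using M CO_perp by blast
    have "perp_set X V \<subseteq> perp_set X U \<inter> perp_set X ?W"
      using perp_set_antitone[OF UV] perp_set_antitone[of ?W V] by blast
    then have "?J \<subseteq> V" using perp_set_antitone stable[OF V] by blast
    moreover have "V \<inter> perp_set X ?J = {omega X}"
      using stable[OF M] disj[OF W] by blast
    ultimately show ?thesis using eq[OF J V] by blast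
  qed
  show ?thesis
  proof unfold_locales
    fix a b assume "a \<in> elems (A0 X)" "b \<in> elems (A0 X)" "ol_le (A0 X) a b"
    then show "b = ol_join (A0 X) a (meet (A0 X) (compl (A0 X) a) b)"
      using om[of a b] by (auto simp: A0_def ol_le_def ol_join_def)
  next
    fix a b assume "ol_le (A0 X) a b"
    then show "ol_le (A0 X) (compl (A0 X) b) (compl (A0 X) a)"
      using perp_set_antitone[of a b] by (auto simp: A0_def ol_le_def)
  qed (use CO_inter CO_perp zero disj stable omega_in in
      \<open>auto simp: A0_def ol_le_def\<close>)
qed

end

(* The homeomorphism sends a point to the filter of clopen stable sets containing it; it reflects
   order and orthogonality by the two separation axioms. For surjectivity, a filter G is realised by
   any point lying in every member of G and in no clopen stable set outside G. Such a point exists by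
   compactness: finitely many members of G contain a common member, which is some principal upset of
   z, and z avoids each clopen stable V outside G, since V is an upset and would otherwise contain
   that member. *)
theory Submission
  imports Defs
begin

definition point_filter :: "('a, 'm) om_space_sig_scheme \<Rightarrow> 'a \<Rightarrow> 'a set set"
  where "point_filter X x = {U \<in> CO_stable X. x \<in> U}"

text \<open>The order of \<open>A0 X\<close> is inclusion, since \<open>U \<inter> V = U\<close>
  says exactly \<open>U \<subseteq> V\<close>.\<close>

lemma filters_A0_iff:
  "G \<in> filters (A0 X) \<longleftrightarrow> G \<subseteq> CO_stable X \<and> G \<noteq> {} \<and>
    (\<forall>U\<in>G. \<forall>V\<in>CO_stable X. U \<subseteq> V \<longrightarrow> V \<in> G) \<and> (\<forall>U\<in>G. \<forall>V\<in>G. U \<inter> V \<in> G)"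
  by (auto simp: filters_def A0_def ol_le_def Int_absorb2 inf.absorb_iff1)

text \<open>A bound inside \<open>G\<close> is claimed rather than
  \<open>\<Inter>\<K> \<in> G\<close> because the empty family has intersection \<open>UNIV\<close>,
  which may fail to be in \<open>G\<close>.\<close>

lemma filter_A0_finite_meet:
  assumes G: "G \<in> filters (A0 X)" and "finite \<K>" "\<K> \<subseteq> G"
  shows "\<exists>U\<in>G. U \<subseteq> \<Inter>\<K>"
  using assms(2,3)
proof (induction \<K> rule: finite_induct)
  case empty
  then show ?case using G by (auto simp: filters_A0_iff)
next
  case (insert V \<K>)
  then obtain U where "U \<in> G" "U \<subseteq> \<Inter>\<K>" by blast
  moreover have "V \<inter> U \<in> G"
    using G insert.prems \<open>U \<in> G\<close> by (auto simp: filters_A0_iff)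
  ultimately show ?case by blast
qed

text \<open>Distinct filters differ in some element \<open>a\<close>, and
  \<open>filters_with A a\<close> and its complement are disjoint subbasic open sets.\<close>

lemma (in orthomodular_lattice) Hausdorff_space_S0: "Hausdorff_space (topo (S0 A))"
proof -
  have open_with: "openin (topo (S0 A)) (filters_with A a)"
    and open_without: "openin (topo (S0 A)) (filters A - filters_with A a)"
    if "a \<in> elems A" for a
    using that by (auto simp: S0_def intro!: topology_generated_by_Basis)
  have sep: "\<exists>U V. openin (topo (S0 A)) U \<and> openin (topo (S0 A)) V \<and> F \<in> U \<and> G \<in> V \<and> disjnt U V"
    if "F \<in> filters A" "G \<in> filters A" "a \<in> F" "a \<notin> G" for F G a
  proof (intro exI conjI)
    have a: "a \<in> elems A" using that by (auto simp: filters_def)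
    show "openin (topo (S0 A)) (filters_with A a)" by (rule open_with[OF a])
    show "openin (topo (S0 A)) (filters A - filters_with A a)" by (rule open_without[OF a])
  qed (use that in \<open>auto simp: filters_with_def disjnt_def\<close>)
  show ?thesis
    unfolding Hausdorff_space_def
  proof (intro allI impI)
    fix F G assume "F \<in> topspace (topo (S0 A)) \<and> G \<in> topspace (topo (S0 A)) \<and> F \<noteq> G"
    then have FG: "F \<in> filters A" "G \<in> filters A" "F \<noteq> G"
      by (auto simp only: topspace_S0) (auto simp: S0_def)
    then consider a where "a \<in> F" "a \<notin> G" | a where "a \<in> G" "a \<notin> F" by blast
    then show "\<exists>U V. openin (topo (S0 A)) U \<and> openin (topo (S0 A)) V \<and> F \<in> U \<and> G \<in> V \<and> disjnt U V"
    proof cases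
      case 1
      then show ?thesis using sep FG by blast
    next
      case 2
      then show ?thesis using sep[of G F] FG disjnt_sym by metis
    qed
  qed
qed

context orthomodular_space
begin

lemma CO_stable_subset: "U \<in> CO_stable X \<Longrightarrow> U \<subseteq> points X"
  by (auto simp: CO_stable_def perp_stable_def)

text \<open>Clopen stable sets are principal upsets, so transitivity suffices.\<close>

lemma CO_stable_upward:
  assumes U: "U \<in> CO_stable X" and "x \<in> U" "(x, y) \<in> le X"
  shows "y \<in> U"
proof -
  obtain z where "U = upset X z" using CO_upset[OF U] by blast
  with assms partial_order_onD(2)[OF partial_order] partial_order show ?thesis
    by (auto simp: upset_def partial_order_on_def preorder_on_def dest: transD)
qed

text \<open>Serves to make every point filter nonempty.\<close>

lemma points_CO_stable: "points X \<in> CO_stable X"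
  using openin_topspace[of "topo X"] closedin_topspace[of "topo X"]
  by (simp add: CO_stable_def perp_stable_def perp_set_points perp_set_omega topspace_topo)

lemma point_filter_in_filters:
  assumes "x \<in> points X"
  shows "point_filter X x \<in> filters (A0 X)"
  using assms points_CO_stable CO_inter unfolding filters_A0_iff point_filter_def by blast

text \<open>If x is not below y, a separating clopen stable set lies in the first filter only; the
  converse holds because these sets are upsets.\<close>

lemma point_filter_subset_iff:
  assumes "x \<in> points X" "y \<in> points X"
  shows "point_filter X x \<subseteq> point_filter X y \<longleftrightarrow> (x, y) \<in> le X"
  using assms CO_stable_upward CO_separates unfolding point_filter_def by blast

lemma point_filter_perp_iff:
  assumes "x \<in> points X" "y \<in> points X"
  shows "(\<exists>U\<in>point_filter X x. perp_set X U \<in> point_filter X y) \<longleftrightarrow> (x, y) \<in> perp X"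
proof
  assume "\<exists>U\<in>point_filter X x. perp_set X U \<in> point_filter X y"
  \<comment> \<open>Here y is in \<open>perp_set X U\<close> and x is in \<open>U\<close>, so the
    pair arises in reversed order.\<close>
  then have "(y, x) \<in> perp X" by (auto simp: point_filter_def perp_set_def)
  then show "(x, y) \<in> perp X" using assms perp_sym by blast
next
  assume "(x, y) \<in> perp X"
  then show "\<exists>U\<in>point_filter X x. perp_set X U \<in> point_filter X y"
    using assms CO_perp_separates CO_perp unfolding point_filter_def by blast
qed

lemma inj_on_point_filter: "inj_on (point_filter X) (points X)"
proof (rule inj_onI)
  fix x y assume "x \<in> points X" "y \<in> points X" "point_filter X x = point_filter X y"
  then have "(x, y) \<in> le X" "(y, x) \<in> le X"
    using point_filter_subset_iff by blast+
  then show "x = y"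
    using partial_order by (auto simp: partial_order_on_def dest: antisymD)
qed

lemma filter_is_point_filter:
  assumes G: "G \<in> filters (A0 X)"
  obtains x where "x \<in> points X" "point_filter X x = G"
proof -
  let ?C = "G \<union> (\<lambda>V. points X - V) ` (CO_stable X - G)"
  have GCO: "G \<subseteq> CO_stable X" and "G \<noteq> {}"
    and up: "\<And>U V. U \<in> G \<Longrightarrow> V \<in> CO_stable X \<Longrightarrow> U \<subseteq> V \<Longrightarrow> V \<in> G"
    using G by (auto simp: filters_A0_iff)
  \<comment> \<open>Both halves of clopenness enter: members of \<open>G\<close> are closed, and
    complements of the other sets are closed because those sets are open.\<close>
  have "closedin (topo X) C" if "C \<in> ?C" for C
    using that GCO openin_closedin_eq[of "topo X"]
    by (auto simp: CO_stable_def topspace_topo[symmetric])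
  moreover have "\<Inter>\<K> \<noteq> {}" if "finite \<K>" "\<K> \<subseteq> ?C" for \<K>
  proof -
    \<comment> \<open>\<open>U\<close> handles the members of \<open>\<K>\<close> from
      \<open>G\<close>; the complements in \<open>\<K>\<close> are handled by its least point
      z.\<close>
    obtain U where U: "U \<in> G" "U \<subseteq> \<Inter>(\<K> \<inter> G)"
      using filter_A0_finite_meet[OF G, of "\<K> \<inter> G"] \<open>finite \<K>\<close> by blast
    obtain z where z: "z \<in> Omega X" "U = upset X z" using CO_upset U GCO by blast
    have zX: "z \<in> points X" using z Omega_subset by blast
    then have zU: "z \<in> U"
      using z partial_order_onD(1)[OF partial_order] by (auto simp: upset_def refl_on_def)
    have "z \<notin> V" if "V \<in> CO_stable X - G" for V
      using that up[OF U(1), of V] CO_stable_upward[of V z] z(2) by (auto simp: upset_def)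
    then have "z \<in> \<Inter>\<K>" using U(2) zU zX \<open>\<K> \<subseteq> ?C\<close> by blast
    then show ?thesis by blast
  qed
  ultimately have "\<Inter>?C \<noteq> {}"
    using compact unfolding compact_space_fip by meson
  then obtain x where x: "x \<in> \<Inter>?C" by blast
  \<comment> \<open>Any member of \<open>G\<close> contains x and lies inside the space.\<close>
  then have "x \<in> points X" using \<open>G \<noteq> {}\<close> GCO CO_stable_subset by blast
  moreover have "point_filter X x = G" using x GCO by (auto simp: point_filter_def)
  ultimately show thesis by (rule that)
qed

lemma image_point_filter: "point_filter X ` points X = filters (A0 X)"
  using point_filter_in_filters filter_is_point_filter by blast

lemma continuous_map_point_filter:
  "continuous_map (topo X) (topo (S0 (A0 X))) (point_filter X)"
proof -
  interpret L: orthomodular_lattice "A0 X" by (rule orthomodular_lattice_A0)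
  let ?S = "filters_with (A0 X) ` elems (A0 X) \<union>
    (\<lambda>a. filters (A0 X) - filters_with (A0 X) a) ` elems (A0 X)"
  \<comment> \<open>Subbasic sets pull back to \<open>U\<close> and its complement, both open since
    \<open>U\<close> is clopen.\<close>
  have pre: "point_filter X -` filters_with (A0 X) U \<inter> points X = U"
    "point_filter X -` (filters (A0 X) - filters_with (A0 X) U) \<inter> points X = points X - U"
    if "U \<in> CO_stable X" for U
    using that CO_stable_subset[OF that] point_filter_in_filters
    by (auto simp: filters_with_def point_filter_def)
  have "openin (topo X) (point_filter X -` W \<inter> topspace (topo X))" if "W \<in> ?S" for W
    using that pre by (auto simp: A0_def[of X] CO_stable_def topspace_topo closedin_def)
  moreover have "point_filter X ` topspace (topo X) \<subseteq> \<Union>?S"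
    using L.topspace_S0 image_point_filter by (simp add: S0_def topspace_topo)
  ultimately have "continuous_map (topo X) (topology_generated_by ?S) (point_filter X)"
    by (rule continuous_on_generated_topo)
  then show ?thesis by (simp add: S0_def)
qed

text \<open>A continuous bijection from a compact space onto a Hausdorff space is a
  homeomorphism.\<close>

lemma homeomorphic_map_point_filter:
  "homeomorphic_map (topo X) (topo (S0 (A0 X))) (point_filter X)"
proof -
  interpret L: orthomodular_lattice "A0 X" by (rule orthomodular_lattice_A0)
  show ?thesis
  proof (rule continuous_imp_homeomorphic_map)
    show "point_filter X ` topspace (topo X) = topspace (topo (S0 (A0 X)))"
      unfolding L.topspace_S0 topspace_topo image_point_filter by (simp add: S0_def)
  qed (simp_all add: compact L.Hausdorff_space_S0 continuous_map_point_filter topspace_topo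
      inj_on_point_filter)
qed

end

theorem theorem3p11:
  fixes X :: "'a om_space_sig"
  assumes "orthomodular_space X"
  shows "\<exists>f. relational_homeomorphism X (S0 (A0 X)) f"
proof -
  interpret orthomodular_space X by (rule assms)
  have "relational_homeomorphism X (S0 (A0 X)) (point_filter X)"
    using homeomorphic_map_point_filter point_filter_in_filters point_filter_subset_iff
      point_filter_perp_iff
    \<comment> \<open>The complement of \<open>A0 X\<close> is \<open>perp_set X\<close>, which
      brings orthogonality of filters into the form of \<open>point_filter_perp_iff\<close>.\<close>
    by (simp add: relational_homeomorphism_def S0_def) (simp add: A0_def)
  then show ?thesis by blast
qed

end
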